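(* Let $0<q<1$, and for integers $n$ put $$\alpha=\frac{q^{1/2}+q^{-1/2}}{2},\qquad \alpha_n=\frac{q^{n/2}+q^{-n/2}}{2},\qquad \gamma_n=\frac{q^{n/2}-q^{-n/2}}{q^{1/2}-q^{-1/2}}.$$ Let $B_0,B_1,C_1,C_2$ be four complex numbers, and set $$a=\frac{\alpha(3-4\alpha^2)}{4\alpha^2-1}+\frac{(B_0+B_1)^2+4\alpha^2(C_1-B_0B_1+\alpha^2-1)}{2\alpha(4\alpha^2-1)C_2},\qquad b=(a+\alpha)B_1-\frac{B_0+B_1}{2\alpha},$$ $$d_n=a\gamma_n+\alpha_n,\qquad e_n=(b+aB_0)\gamma_n+B_0\alpha_n,$$ $$\phi^{[n]}(z)=\big((\alpha^2-1)\gamma_{2n}+a\alpha_{2n}\big)\big(z^2-\tfrac12\big)-\big((b+aB_0)\alpha_n+(\alpha^2-1)B_0\gamma_n\big)z+bB_0-(a+\alpha)C_1+\tfrac a2 .$$ Assume that the sequences $(B_n)_{n\ge0}$ and $(C_n)_{n\ge1}$ given by $$B_n=\frac{\gamma_{n+1}e_n}{d_{2n}}-\frac{\gamma_ne_{n-1}}{d_{2n-2}},\qquad C_{n+1}=-\frac{\gamma_{n+1}d_{n-1}}{d_{2n-1}d_{2n+1}}\,\phi^{[n]}\!\left(\frac{e_n}{d_{2n}}\right),\qquad n=0,1,2,\dots,$$ are well defined (that is, $C_2\neq0$ and no denominator vanishes), and that $C_n\ne0$ for each $n=1,2,\dots$. Here, for $n=0$, the term $\gamma_0e_{-1}/d_{-2}$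 is read as $0$ (since $\gamma_0=0$) and $d_{-1}/d_{-1}$ is read as $1$. If $(P_n)_{n\ge0}$ is a monic orthogonal polynomial sequence whose three-term recurrence relation is $$xP_n(x)=P_{n+1}(x)+B_nP_n(x)+C_nP_{n-1}(x),\qquad n=0,1,2,\dots,\quad P_{-1}=0,$$ with these coefficients $(B_n)_{n\ge0}$ and $(C_n)_{n\ge1}$, then $(P_n)_{n\ge0}$ is classical (with respect to the Askey-Wilson operator $\mathcal{D}_q$).
   Context: Let $\mathcal{P}$ be the vector space of all polynomials with complex coefficients and $\mathcal{P}^*$ its algebraic dual; $\langle \mathbf{u},f\rangle$ denotes the action of $\mathbf{u}\in\mathcal{P}^*$ on $f\in\mathcal{P}$. A sequence $(P_n)_{n\ge0}$ in $\mathcal{P}$ with $\deg P_n=n$ for each $n$ is called an orthogonal polynomial sequence (OPS) with respect to $\mathbf{u}\in\mathcal{P}^*$ if $\langle \mathbf{u},P_nP_m\rangle=\kappa_n\delta_{n,m}$ for all $n,m\ge0$, with $\kappa_n\in\mathbb{C}\setminus\{0\}$. (No positivity is assumed.) The Askey-Wilson operator $\mathcal{D}_q:\mathcal{P}\to\mathcal{P}$ ($0<q<1$) is defined by $$(\mathcal{D}_qf)(x)=\frac{\breve f(q^{1/2}z)-\breve f(q^{-1/2}z)}{\breve e(q^{1/2}z)-\breve e(q^{-1/2}z)},\qquad x=\tfrac12(z+1/z),$$ where $\breve f(z)=f\big((z+1/z)/2\big)$ and $e(x)=x$. A monic OPS $(P_n)_{n\ge0}$ (with respect to some $\mathbf{u}\in\mathcal{P}^*$)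 is called classical if the sequence $(\mathcal{D}_qP_{n+1})_{n\ge0}$ is an OPS (with respect to some functional in $\mathcal{P}^*$). In the claim, $\phi^{[n]}$ is just notation for a family of polynomials indexed by $n$ (not a derivative or iterate). *)

theory Defs
  imports "HOL-Analysis.Analysis"
begin

section \<open>Orthogonal polynomial sequences\<close>

text \<open>The algebraic dual of \<open>complex poly\<close> consists of the \<open>u\<close> satisfying
  \<open>Vector_Spaces.linear smult (*) u\<close>. The conjunct \<open>P n \<noteq> 0\<close> is there because
  \<open>degree 0 = 0\<close> in the library.\<close>

definition OPS_wrt :: "(complex poly \<Rightarrow> complex) \<Rightarrow> (nat \<Rightarrow> complex poly) \<Rightarrow> bool" where
  "OPS_wrt u P \<longleftrightarrow>
     Vector_Spaces.linear smult (*) u \<and>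
     (\<forall>n. P n \<noteq> 0 \<and> degree (P n) = n) \<and>
     (\<exists>\<kappa>. (\<forall>n. \<kappa> n \<noteq> 0) \<and>
          (\<forall>n m. u (P n * P m) = (if n = m then \<kappa> n else 0)))"

definition OPS :: "(nat \<Rightarrow> complex poly) \<Rightarrow> bool" where
  "OPS P \<longleftrightarrow> (\<exists>u. OPS_wrt u P)"

definition monic_OPS :: "(nat \<Rightarrow> complex poly) \<Rightarrow> bool" where
  "monic_OPS P \<longleftrightarrow> OPS P \<and> (\<forall>n. lead_coeff (P n) = 1)"


section \<open>The Askey-Wilson operator\<close>

definition breve :: "complex poly \<Rightarrow> complex \<Rightarrow> complex" where
  "breve f z = poly f ((z + 1 / z) / 2)"

text \<open>The polynomial \<open>e(x) = x\<close> is \<open>[:0, 1:]\<close>. The quotient determines a polynomial in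
  \<open>x = (z + 1/z)/2\<close> from its values at the \<open>z \<noteq> 0\<close> where the denominator
  \<open>(q powr (1/2) - q powr (-1/2)) (z - 1/z) / 2\<close> does not vanish, that is, \<open>z\<^sup>2 \<noteq> 1\<close>.
  Existence and uniqueness for \<open>0 < q < 1\<close> are the lemma \<open>askey_wilson_ex1\<close> below.\<close>

definition is_askey_wilson_image :: "real \<Rightarrow> complex poly \<Rightarrow> complex poly \<Rightarrow> bool" where
  "is_askey_wilson_image q f g \<longleftrightarrow>
     (\<forall>z. z \<noteq> 0 \<longrightarrow> z\<^sup>2 \<noteq> 1 \<longrightarrow>
        poly g ((z + 1 / z) / 2) =
          (breve f (of_real (q powr (1/2)) * z) - breve f (of_real (q powr (-1/2)) * z)) /
          (breve [:0, 1:] (of_real (q powr (1/2)) * z) - breve [:0, 1:] (of_real (q powr (-1/2)) * z)))"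

definition askey_wilson :: "real \<Rightarrow> complex poly \<Rightarrow> complex poly" where
  "askey_wilson q f = (THE g. is_askey_wilson_image q f g)"

definition classical :: "real \<Rightarrow> (nat \<Rightarrow> complex poly) \<Rightarrow> bool" where
  "classical q P \<longleftrightarrow> monic_OPS P \<and> OPS (\<lambda>n. askey_wilson q (P (Suc n)))"


section \<open>The numbers \<open>\<alpha>\<^sub>n\<close> and \<open>\<gamma>\<^sub>n\<close>\<close>

definition aw_alpha :: "real \<Rightarrow> int \<Rightarrow> real" where
  "aw_alpha q n = (q powr (real_of_int n / 2) + q powr (- real_of_int n / 2)) / 2"

definition aw_gamma :: "real \<Rightarrow> int \<Rightarrow> real" where
  "aw_gamma q n = (q powr (real_of_int n / 2) - q powr (- real_of_int n / 2)) /
                  (q powr (1/2) - q powr (-1/2))"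


section \<open>The Askey-Wilson operator is well defined\<close>

lemma joukowski_surj:
  fixes x :: complex
  assumes "x\<^sup>2 \<noteq> 1"
  obtains z where "z \<noteq> 0" "z\<^sup>2 \<noteq> 1" "(z + 1 / z) / 2 = x"
proof -
  define w where "w = csqrt (x\<^sup>2 - 1)"
  define z where "z = x + w"
  have w2: "w\<^sup>2 = x\<^sup>2 - 1"
    by (simp add: w_def)
  have inv: "z * (x - w) = 1"
    using w2 by (simp add: z_def algebra_simps power2_eq_square)
  have z0: "z \<noteq> 0"
    using inv by auto
  have "1 / z = x - w"
    using inv z0 by (simp add: field_simps)
  hence zx: "(z + 1 / z) / 2 = x"
    by (simp add: z_def)
  have "z\<^sup>2 \<noteq> 1"
  proof
    assume "z\<^sup>2 = 1"
    hence "z = 1 \<or> z = -1"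
      by (simp add: power2_eq_1_iff)
    hence "x = 1 \<or> x = -1"
      using zx by auto
    thus False
      using assms by auto
  qed
  thus ?thesis
    using that z0 zx by blast
qed

lemma askey_wilson_image_unique:
  assumes "is_askey_wilson_image q f g" "is_askey_wilson_image q f h"
  shows "g = h"
proof (rule ccontr)
  assume "g \<noteq> h"
  hence fin: "finite {x. poly (g - h) x = 0}"
    by (intro poly_roots_finite) simp
  have "x \<in> {x. poly (g - h) x = 0} \<union> {1, -1}" for x
  proof (cases "x\<^sup>2 = 1")
    case True
    thus ?thesis
      by (auto simp: power2_eq_1_iff)
  next
    case False
    then obtain z where z: "z \<noteq> 0" "z\<^sup>2 \<noteq> 1" and x: "(z + 1 / z) / 2 = x"
      by (rule joukowski_surj)
    have "poly g ((z + 1 / z) / 2) = poly h ((z + 1 / z) / 2)"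
      using assms z unfolding is_askey_wilson_image_def by metis
    thus ?thesis
      by (simp add: x)
  qed
  hence "UNIV = {x. poly (g - h) x = 0} \<union> {1, -1}"
    by auto
  hence "finite (UNIV :: complex set)"
    using fin by (metis finite.emptyI finite.insertI finite_UnI)
  thus False
    using infinite_UNIV_char_0 by blast
qed

text \<open>Existence follows from the product rule with one factor \<open>x\<close>, carried along with the
  averaging operator whose value at \<open>f\<close> is the polynomial \<open>s\<close> below.\<close>

lemma askey_wilson_image_aux:
  fixes p r :: complex
  assumes pr: "p * r = 1"
  shows "\<exists>s g. \<forall>z. z \<noteq> 0 \<longrightarrow>
           2 * poly s ((z + 1 / z) / 2) = breve f (p * z) + breve f (r * z) \<and>
           (p - r) * (z - 1 / z) / 2 * poly g ((z + 1 / z) / 2) = breve f (p * z) - breve f (r * z)"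
proof (induction f)
  case 0
  show ?case
    by (rule exI[of _ 0], rule exI[of _ 0]) (simp add: breve_def)
next
  case (pCons c f)
  from pCons.IH obtain s g where sg: "\<And>z. z \<noteq> 0 \<Longrightarrow>
      2 * poly s ((z + 1 / z) / 2) = breve f (p * z) + breve f (r * z)"
      "\<And>z. z \<noteq> 0 \<Longrightarrow>
      (p - r) * (z - 1 / z) / 2 * poly g ((z + 1 / z) / 2) = breve f (p * z) - breve f (r * z)"
    by blast
  define A where "A = (p + r) / 2"
  define s' where "s' = [:c:] + [:0, A:] * s + smult (A\<^sup>2 - 1) ([:-1, 0, 1:] * g)"
  define g' where "g' = s + [:0, A:] * g"
  have p0: "p \<noteq> 0" and r0: "r \<noteq> 0"
    using pr by auto
  have ip: "inverse p = r" and ir: "inverse r = p"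
    using pr p0 r0 by (auto simp: field_simps)
  show ?case
  proof (rule exI[of _ s'], rule exI[of _ g'], intro allI impI conjI)
    fix z :: complex
    assume z: "z \<noteq> 0"
    define y where "y = 1 / z"
    have zy: "z * y = 1"
      using z by (simp add: y_def)
    define x where "x = (z + y) / 2"
    have Xp: "(p * z + 1 / (p * z)) / 2 = (p * z + r * y) / 2"
      using z p0 by (simp add: y_def ip[symmetric] field_simps)
    have Xr: "(r * z + 1 / (r * z)) / 2 = (r * z + p * y) / 2"
      using z r0 by (simp add: y_def ir[symmetric] field_simps)
    define F where "F = breve f (p * z)"
    define G where "G = breve f (r * z)"
    define S where "S = poly s x"
    define D where "D = poly g x"
    have bF: "breve (pCons c f) (p * z) = c + (p * z + r * y) / 2 * F"
      unfolding F_def breve_def Xp by simp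
    have bG: "breve (pCons c f) (r * z) = c + (r * z + p * y) / 2 * G"
      unfolding G_def breve_def Xr by simp
    have e1: "2 * S = F + G"
      using sg(1)[OF z] by (simp add: S_def F_def G_def x_def y_def)
    have e2: "(p - r) * (z - y) / 2 * D = F - G"
      using sg(2)[OF z] by (simp add: D_def F_def G_def x_def y_def)
    have F: "F = S + (p - r) * (z - y) / 4 * D" and G: "G = S - (p - r) * (z - y) / 4 * D"
      using e1 e2 by (simp_all add: field_simps, algebra+)
    have s'x: "poly s' x = c + A * x * S + (A\<^sup>2 - 1) * (x\<^sup>2 - 1) * D"
      by (simp add: s'_def S_def D_def power2_eq_square algebra_simps)
    have g'x: "poly g' x = S + A * x * D"
      by (simp add: g'_def S_def D_def algebra_simps)
    have A1: "A\<^sup>2 - 1 = (p - r)\<^sup>2 / 4"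
    proof -
      have "A\<^sup>2 - p * r = (p - r)\<^sup>2 / 4"
        by (simp add: A_def power2_eq_square field_simps)
      thus ?thesis by (simp add: pr)
    qed
    have x1: "x\<^sup>2 - 1 = (z - y)\<^sup>2 / 4"
    proof -
      have "x\<^sup>2 - z * y = (z - y)\<^sup>2 / 4"
        by (simp add: x_def power2_eq_square field_simps)
      thus ?thesis by (simp add: zy)
    qed
    have "2 * poly s' x = breve (pCons c f) (p * z) + breve (pCons c f) (r * z)"
      unfolding s'x bF bG F G A1 x1
      by (simp add: A_def x_def power2_eq_square field_simps)
    thus "2 * poly s' ((z + 1 / z) / 2) = breve (pCons c f) (p * z) + breve (pCons c f) (r * z)"
      by (simp add: x_def y_def)
    have "(p - r) * (z - y) / 2 * poly g' x = breve (pCons c f) (p * z) - breve (pCons c f) (r * z)"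
      unfolding g'x bF bG F G
      by (simp add: A_def x_def power2_eq_square field_simps)
    thus "(p - r) * (z - 1 / z) / 2 * poly g' ((z + 1 / z) / 2) =
            breve (pCons c f) (p * z) - breve (pCons c f) (r * z)"
      by (simp add: x_def y_def)
  qed
qed

lemma askey_wilson_ex1:
  assumes q: "0 < q" "q < 1"
  shows "\<exists>!g. is_askey_wilson_image q f g"
proof (rule ex_ex1I)
  show "g = h" if "is_askey_wilson_image q f g" "is_askey_wilson_image q f h" for g h
    using that by (rule askey_wilson_image_unique)
next
  define p :: complex where "p = of_real (q powr (1/2))"
  define r :: complex where "r = of_real (q powr (-1/2))"
  have pr: "p * r = 1"
    using q by (simp add: p_def r_def powr_add[symmetric] flip: of_real_mult)
  have "q powr (1/2) < q powr (-1/2)"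
    using q by (intro powr_less_mono') auto
  hence ne: "p - r \<noteq> 0"
    by (simp add: p_def r_def)
  obtain s g where g: "\<And>z. z \<noteq> 0 \<Longrightarrow>
      (p - r) * (z - 1 / z) / 2 * poly g ((z + 1 / z) / 2) = breve f (p * z) - breve f (r * z)"
    using askey_wilson_image_aux[OF pr, of f] by blast
  have p0: "p \<noteq> 0" and r0: "r \<noteq> 0"
    using pr by auto
  have ip: "r = 1 / p"
    using pr p0 by (auto simp: field_simps)
  have "is_askey_wilson_image q f g"
    unfolding is_askey_wilson_image_def p_def[symmetric] r_def[symmetric]
  proof (intro allI impI)
    fix z :: complex
    assume z: "z \<noteq> 0" "z\<^sup>2 \<noteq> 1"
    have den: "breve [:0, 1:] (p * z) - breve [:0, 1:] (r * z) = (p - r) * (z - 1 / z) / 2"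
      using z p0 by (simp add: breve_def ip field_simps)
    have "z - 1 / z \<noteq> 0"
      using z by (auto simp: field_simps power2_eq_square)
    hence "(p - r) * (z - 1 / z) / 2 \<noteq> 0"
      using ne by simp
    thus "poly g ((z + 1 / z) / 2) =
        (breve f (p * z) - breve f (r * z)) / (breve [:0, 1:] (p * z) - breve [:0, 1:] (r * z))"
      unfolding den g[OF z(1), symmetric] by simp
  qed
  thus "\<exists>g. is_askey_wilson_image q f g" ..
qed

end

theory Submission
  imports Defs
begin

text \<open>The Askey-Wilson operator satisfies
  \<open>D (x\<^sup>2 f) = 2 \<alpha> x D (x f) - (x\<^sup>2 + \<alpha>\<^sup>2 - 1) D f\<close>, so applying it to the
  three-term recurrence iterated twice gives a five-term recurrence for \<open>D P\<^sub>n\<close>. With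
  \<open>\<sigma>\<^sub>n = e\<^sub>n / d\<^sub>2\<^sub>n\<close> we have \<open>B\<^sub>n = \<gamma>\<^sub>n\<^sub>+\<^sub>1 \<sigma>\<^sub>n - \<gamma>\<^sub>n \<sigma>\<^sub>n\<^sub>-\<^sub>1\<close>; the
  five-term recurrence is solved by \<open>\<gamma>\<^sub>n R\<^sub>n\<^sub>-\<^sub>1\<close>, where the monic \<open>R\<^sub>n\<close> have recurrence coefficients
  \<open>\<beta>\<^sub>n = \<gamma>\<^sub>n\<^sub>+\<^sub>1 \<sigma>\<^sub>n\<^sub>+\<^sub>1 - \<gamma>\<^sub>n \<sigma>\<^sub>n\<close> and
  \<open>\<zeta>\<^sub>n = \<gamma>\<^sub>n d\<^sub>n C\<^sub>n\<^sub>+\<^sub>1 / (\<gamma>\<^sub>n\<^sub>+\<^sub>1 d\<^sub>n\<^sub>-\<^sub>1) \<noteq> 0\<close> for \<open>n \<ge> 1\<close>. By Favard's theorem they form an OPS.\<close>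

section \<open>Favard's theorem\<close>

text \<open>The values at x^n of the functional, forced by sending 1 to 1 and every later
  \<open>Q n\<close> to 0 when \<open>Q n\<close> is monic of degree n.\<close>

fun favard_moment :: "(nat \<Rightarrow> complex poly) \<Rightarrow> nat \<Rightarrow> complex" where
  "favard_moment Q n = (if n = 0 then 1 else - (\<Sum>i<n. coeff (Q n) i * favard_moment Q i))"

declare favard_moment.simps [simp del]

fun ttr_poly :: "(nat \<Rightarrow> complex) \<Rightarrow> (nat \<Rightarrow> complex) \<Rightarrow> nat \<Rightarrow> complex poly" where
  "ttr_poly \<beta> \<zeta> 0 = 1"
| "ttr_poly \<beta> \<zeta> (Suc 0) = [:- \<beta> 0, 1:]"
| "ttr_poly \<beta> \<zeta> (Suc (Suc n)) =
     [:- \<beta> (n + 1), 1:] * ttr_poly \<beta> \<zeta> (n + 1) - smult (\<zeta> (n + 1)) (ttr_poly \<beta> \<zeta> n)"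

text \<open>The recurrence trades a factor x for neighbouring indices, so x^k is orthogonal to
  \<open>Q n\<close> for k < n and the norms are products of the nonzero \<zeta>. The factors
  \<open>c n\<close> allow for images under the operator that are not monic.\<close>

theorem favard:
  assumes \<zeta>: "\<And>n. \<zeta> (n + 1) \<noteq> 0" and c: "\<And>n. c n \<noteq> 0"
  shows "OPS (\<lambda>n. smult (c n) (ttr_poly \<beta> \<zeta> n))"
proof -
  define Q where "Q = ttr_poly \<beta> \<zeta>"
  have Q0: "Q 0 = 1" and Q1: "Q 1 = [:- \<beta> 0, 1:]"
    and rec: "Q (n + 2) = [:- \<beta> (n + 1), 1:] * Q (n + 1) - smult (\<zeta> (n + 1)) (Q n)" for n
    by (simp_all add: Q_def)
  have deg: "degree (Q n) = n \<and> lead_coeff (Q n) = 1" for n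
  proof (induction n rule: less_induct)
    case (less n)
    consider "n = 0" | "n = 1" | m where "n = m + 2"
      by (metis One_nat_def add_2_eq_Suc' not0_implies_Suc)
    thus ?case
    proof cases
      case 3
      have IH: "degree (Q (m + 1)) = m + 1" "lead_coeff (Q (m + 1)) = 1" "degree (Q m) = m"
        using less.IH[of "m + 1"] less.IH[of m] 3 by auto
      let ?F = "[:- \<beta> (m + 1), 1:] * Q (m + 1)" and ?G = "- smult (\<zeta> (m + 1)) (Q m)"
      have Qne: "Q (m + 1) \<noteq> 0"
        using IH by auto
      have F: "degree ?F = m + 2" "lead_coeff ?F = 1"
        using Qne IH by (simp_all only: lead_coeff_mult) (subst degree_mult_eq, simp_all)
      have G: "degree ?G < degree ?F"
        using IH F(1) by simp
      have "Q n = ?F + ?G"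
        using rec[of m] 3 by simp
      thus ?thesis
        using F degree_add_eq_left[OF G] lead_coeff_add_le[of ?G ?F] G coeff_eq_0[OF G] 3
        by simp
    qed (use Q0 Q1 in auto)
  qed
  have coeff_Q: "coeff (Q n) n = 1" for n
    using deg[of n] by auto
  define u where "u f = (\<Sum>i\<le>degree f. coeff f i * favard_moment Q i)" for f
  \<comment> \<open>Any degree bound may replace the exact degree, so polynomials of different
    degrees can be added termwise.\<close>
  have u_eq: "u f = (\<Sum>i\<le>N. coeff f i * favard_moment Q i)" if "degree f \<le> N" for f N
    unfolding u_def using that by (intro sum.mono_neutral_left) (auto simp: coeff_eq_0)
  have u_add: "u (f + g) = u f + u g" for f g
  proof -
    let ?N = "max (degree f) (degree g)"
    have "degree (f + g) \<le> ?N"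
      by (rule degree_add_le_max)
    thus ?thesis
      by (simp add: u_eq[of _ ?N] sum.distrib algebra_simps)
  qed
  have u_smult: "u (smult k f) = k * u f" for k f
    by (simp add: u_eq[of "smult k f" "degree f"] degree_smult_le u_def sum_distrib_left mult.assoc)
  have u_0: "u 0 = 0"
    by (simp add: u_def)
  have u_linear: "Vector_Spaces.linear smult (*) u"
    by unfold_locales (auto simp: u_add u_smult algebra_simps smult_add_left smult_add_right)
  have u_Q: "u (Q n) = (if n = 0 then 1 else 0)" for n
  proof (cases "n = 0")
    case False
    have "u (Q n) = (\<Sum>i<n. coeff (Q n) i * favard_moment Q i) + coeff (Q n) n * favard_moment Q n"
      using deg[of n] by (simp add: u_def flip: lessThan_Suc_atMost)
    thus ?thesis
      using False by (simp add: coeff_Q favard_moment.simps[of Q n])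
  qed (simp add: Q0 u_def favard_moment.simps)
  have xQ: "[:0, 1:] * Q (n + 1) = Q (n + 2) + smult (\<beta> (n + 1)) (Q (n + 1)) + smult (\<zeta> (n + 1)) (Q n)"
    for n unfolding rec[of n] by simp
  have step: "u (monom 1 (k + 1) * Q (n + 1)) = u (monom 1 k * Q (n + 2))
      + \<beta> (n + 1) * u (monom 1 k * Q (n + 1)) + \<zeta> (n + 1) * u (monom 1 k * Q n)" for k n
  proof -
    have "monom 1 (k + 1) * Q (n + 1) = monom 1 k * ([:0, 1:] * Q (n + 1))"
      by (simp add: monom_Suc)
    thus ?thesis
      unfolding xQ by (simp add: algebra_simps u_add u_smult)
  qed
  \<comment> \<open>\<open>step\<close> lowers the power by one and the index by at most one, which
    preserves k < n. Hence induction on k for all n.\<close>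
  have low: "u (monom 1 k * Q n) = 0" if "k < n" for k n
    using that
  proof (induction k arbitrary: n)
    case (Suc k)
    then obtain m where n: "n = m + 1" "k < m"
      by (metis Suc_less_eq2 Suc_eq_plus1)
    show ?case
      using step[of k m] Suc.IH[of m] Suc.IH[of "m + 1"] Suc.IH[of "m + 2"] n by simp
  qed (simp add: u_Q)
  define \<kappa> where "\<kappa> n = u (monom 1 n * Q n)" for n
  \<comment> \<open>In \<open>step\<close> with k = n only the last term survives:
    \<open>\<kappa> (n + 1) = \<zeta> (n + 1) * \<kappa> n\<close>.\<close>
  have \<kappa>: "\<kappa> n \<noteq> 0" for n
  proof (induction n)
    case (Suc n)
    thus ?case
      using step[of n n] low[of n "n + 1"] low[of n "n + 2"] \<zeta>[of n] by (simp add: \<kappa>_def)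
  qed (simp add: \<kappa>_def u_Q)
  have u_sum: "u (\<Sum>i\<in>A. f i) = (\<Sum>i\<in>A. u (f i))" for A :: "nat set" and f
    by (induction A rule: infinite_finite_induct) (simp_all add: u_add u_0)
  have u_low: "u (f * Q n) = coeff f n * \<kappa> n" if "degree f \<le> n" for f n
  proof -
    have "u (f * Q n) = u ((\<Sum>i\<le>n. smult (coeff f i) (monom 1 i)) * Q n)"
      using poly_as_sum_of_monoms'[OF that] by (simp add: smult_monom)
    also have "\<dots> = (\<Sum>i\<le>n. coeff f i * u (monom 1 i * Q n))"
      by (simp add: sum_distrib_right u_sum u_smult)
    also have "\<dots> = (\<Sum>i\<in>{n}. coeff f i * u (monom 1 i * Q n))"
      by (intro sum.mono_neutral_right) (auto simp: low)
    finally show ?thesis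
      by (simp add: \<kappa>_def)
  qed
  have orth: "u (Q n * Q m) = (if n = m then \<kappa> n else 0)" for n m
  proof (cases "n \<le> m")
    case True
    have "u (Q n * Q m) = coeff (Q n) m * \<kappa> m"
      using deg True by (intro u_low) auto
    thus ?thesis
      using deg[of n] True by (auto simp: coeff_Q coeff_eq_0)
  next
    case False
    have "u (Q m * Q n) = coeff (Q m) n * \<kappa> n"
      using deg False by (intro u_low) auto
    thus ?thesis
      using deg[of m] False by (auto simp: coeff_Q coeff_eq_0 mult.commute)
  qed
  have "OPS_wrt u (\<lambda>n. smult (c n) (Q n))"
    unfolding OPS_wrt_def
  proof (intro conjI allI exI[of _ "\<lambda>n. c n * c n * \<kappa> n"])
    show "smult (c n) (Q n) \<noteq> 0" for n
      using deg[of n] c[of n] by auto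
  qed (use u_linear deg c \<kappa> in \<open>auto simp: u_smult orth\<close>)
  thus ?thesis
    unfolding OPS_def Q_def by blast
qed

section \<open>Algebraic rules for the Askey-Wilson operator\<close>

lemma askey_wilson_image:
  assumes "0 < q" "q < 1"
  shows "is_askey_wilson_image q f (askey_wilson q f)"
  unfolding askey_wilson_def by (rule theI') (rule askey_wilson_ex1[OF assms])

lemma askey_wilson_eqI:
  assumes "is_askey_wilson_image q f g"
  shows "askey_wilson q f = g"
  unfolding askey_wilson_def using assms askey_wilson_image_unique by blast

lemma askey_wilson_add:
  assumes "0 < q" "q < 1"
  shows "askey_wilson q (f + g) = askey_wilson q f + askey_wilson q g"
  using askey_wilson_image[OF assms, of f] askey_wilson_image[OF assms, of g]
  by (intro askey_wilson_eqI)
     (simp add: is_askey_wilson_image_def breve_def add_divide_distrib diff_divide_distrib)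

lemma askey_wilson_smult:
  assumes "0 < q" "q < 1"
  shows "askey_wilson q (smult c f) = smult c (askey_wilson q f)"
  using askey_wilson_image[OF assms, of f]
  by (intro askey_wilson_eqI)
     (simp add: is_askey_wilson_image_def breve_def right_diff_distrib)

lemma askey_wilson_one: "askey_wilson q 1 = 0"
  by (intro askey_wilson_eqI) (simp add: is_askey_wilson_image_def breve_def)

lemma askey_wilson_denominator:
  fixes z :: complex
  assumes q: "0 < q" "q < 1" and z: "z \<noteq> 0" "z\<^sup>2 \<noteq> 1"
  shows "breve [:0, 1:] (of_real (q powr (1/2)) * z) - breve [:0, 1:] (of_real (q powr (-1/2)) * z) \<noteq> 0"
proof -
  define p where "p = (of_real (q powr (1/2)) :: complex)"
  define r where "r = (of_real (q powr (-1/2)) :: complex)"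
  have pr: "p * r = 1"
    using q by (simp add: p_def r_def powr_add[symmetric] flip: of_real_mult)
  have "q powr (1/2) < q powr (-1/2)"
    using q by (intro powr_less_mono') auto
  hence ne: "p - r \<noteq> 0"
    by (simp add: p_def r_def)
  have p0: "p \<noteq> 0"
    using pr by auto
  hence r: "r = 1 / p"
    using pr by (simp add: field_simps)
  have *: "breve [:0, 1:] (p * z) - breve [:0, 1:] (r * z) = (p - r) * (z - 1 / z) / 2"
    using z p0 by (simp add: breve_def r field_simps)
  have "z - 1 / z \<noteq> 0"
    using z by (auto simp: field_simps power2_eq_square)
  thus ?thesis
    using ne unfolding p_def[symmetric] r_def[symmetric] * by simp
qed

lemma askey_wilson_X:
  assumes "0 < q" "q < 1"
  shows "askey_wilson q [:0, 1:] = 1"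
  using askey_wilson_denominator[OF assms]
  by (intro askey_wilson_eqI) (simp add: is_askey_wilson_image_def)

text \<open>Both shifted points \<open>(p z + 1/(p z))/2\<close> and \<open>(r z + 1/(r z))/2\<close> with \<open>p = q\<^sup>1\<^sup>/\<^sup>2 = 1/r\<close> are roots
  of \<open>X\<^sup>2 - 2 \<alpha> x X + x\<^sup>2 + \<alpha>\<^sup>2 - 1\<close>.\<close>

lemma askey_wilson_X2:
  fixes A :: complex
  assumes q: "0 < q" "q < 1" and A: "A = of_real ((q powr (1/2) + q powr (-1/2)) / 2)"
  shows "askey_wilson q ([:0, 1:] * ([:0, 1:] * f)) =
    [:0, 2 * A:] * askey_wilson q ([:0, 1:] * f) - [:A\<^sup>2 - 1, 0, 1:] * askey_wilson q f"
proof (rule askey_wilson_eqI, unfold is_askey_wilson_image_def, intro allI impI)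
  fix z :: complex
  assume z: "z \<noteq> 0" "z\<^sup>2 \<noteq> 1"
  define p where "p = (of_real (q powr (1/2)) :: complex)"
  define r where "r = (of_real (q powr (-1/2)) :: complex)"
  have pr: "p * r = 1"
    using q by (simp add: p_def r_def powr_add[symmetric] flip: of_real_mult)
  have p0: "p \<noteq> 0"
    using pr by auto
  hence r: "r = 1 / p"
    using pr by (simp add: field_simps)
  have A': "A = (p + r) / 2"
    by (simp add: A p_def r_def)
  define x where "x = (z + 1 / z) / 2"
  define U where "U = (p * z + 1 / (p * z)) / 2"
  define V where "V = (r * z + 1 / (r * z)) / 2"
  define \<Delta> where "\<Delta> = breve [:0, 1:] (p * z) - breve [:0, 1:] (r * z)"
  have \<Delta>: "\<Delta> \<noteq> 0"
    using askey_wilson_denominator[OF q z] by (simp add: \<Delta>_def p_def r_def)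
  have U: "U\<^sup>2 = 2 * A * x * U - (A\<^sup>2 - 1 + x\<^sup>2)" and V: "V\<^sup>2 = 2 * A * x * V - (A\<^sup>2 - 1 + x\<^sup>2)"
    unfolding U_def V_def x_def A' r using p0 z(1) by (simp_all add: field_simps power2_eq_square)
  \<comment> \<open>Cleared of the denominator, the claim is linear in the values of f at
    \<open>U\<close> and \<open>V\<close>.\<close>
  have D: "\<Delta> * poly (askey_wilson q g) x = breve g (p * z) - breve g (r * z)" for g
    using askey_wilson_image[OF q, of g] z \<Delta>
    unfolding is_askey_wilson_image_def p_def[symmetric] r_def[symmetric] x_def \<Delta>_def by simp
  have b: "breve ([:0, 1:] * g) (p * z) = U * breve g (p * z)"
    "breve ([:0, 1:] * g) (r * z) = V * breve g (r * z)" for g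
    by (simp_all add: breve_def U_def V_def)
  have "\<Delta> * poly ([:0, 2 * A:] * askey_wilson q ([:0, 1:] * f) - [:A\<^sup>2 - 1, 0, 1:] * askey_wilson q f) x
      = 2 * A * x * (\<Delta> * poly (askey_wilson q ([:0, 1:] * f)) x)
        - (A\<^sup>2 - 1 + x\<^sup>2) * (\<Delta> * poly (askey_wilson q f) x)"
    by (simp add: algebra_simps power2_eq_square)
  also have "\<dots> = U\<^sup>2 * breve f (p * z) - V\<^sup>2 * breve f (r * z)"
    unfolding D b U V by (simp add: algebra_simps)
  also have "\<dots> = breve ([:0, 1:] * ([:0, 1:] * f)) (p * z) - breve ([:0, 1:] * ([:0, 1:] * f)) (r * z)"
    unfolding b by (simp add: power2_eq_square)
  finally show "poly ([:0, 2 * A:] * askey_wilson q ([:0, 1:] * f) - [:A\<^sup>2 - 1, 0, 1:] * askey_wilson q f)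
        ((z + 1 / z) / 2) =
      (breve ([:0, 1:] * ([:0, 1:] * f)) (of_real (q powr (1/2)) * z)
        - breve ([:0, 1:] * ([:0, 1:] * f)) (of_real (q powr (-1/2)) * z)) /
      (breve [:0, 1:] (of_real (q powr (1/2)) * z) - breve [:0, 1:] (of_real (q powr (-1/2)) * z))"
    using \<Delta> unfolding p_def[symmetric] r_def[symmetric] x_def[symmetric] \<Delta>_def[symmetric]
    by (simp add: field_simps)
qed

section \<open>Recurrences for \<open>\<alpha>\<^sub>n\<close> and \<open>\<gamma>\<^sub>n\<close>\<close>

lemma aw_gamma_0: "aw_gamma q 0 = 0"
  by (simp add: aw_gamma_def)

lemma powr_half_less:
  assumes "0 < q" "q < (1::real)"
  shows "q powr (1/2) < q powr (-1/2)"
  using assms by (intro powr_less_mono') auto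

lemma aw_gamma_1:
  assumes "0 < q" "q < 1"
  shows "aw_gamma q 1 = 1"
  using powr_half_less[OF assms] by (simp add: aw_gamma_def)

lemma aw_gamma_pos:
  assumes q: "0 < q" "q < 1" and "n > 0"
  shows "aw_gamma q n > 0"
proof -
  have "q powr (n / 2) < q powr (- n / 2)"
    using assms by (intro powr_less_mono') auto
  thus ?thesis
    using powr_half_less[OF q] by (simp add: aw_gamma_def divide_neg_neg)
qed

text \<open>Everything is written in the two positive numbers q^(n/2) and q^(1/2), so the relations
  below become rational identities in them.\<close>

lemma aw_values:
  fixes n :: int
  assumes "0 < q"
  shows "aw_alpha q 1 = (q powr (1/2) + 1 / q powr (1/2)) / 2"
    "aw_alpha q n = (q powr (n/2) + 1 / q powr (n/2)) / 2"
    "aw_alpha q (n + 1) = (q powr (n/2) * q powr (1/2) + 1 / (q powr (n/2) * q powr (1/2))) / 2"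
    "aw_alpha q (n - 1) = (q powr (n/2) / q powr (1/2) + q powr (1/2) / q powr (n/2)) / 2"
    "aw_gamma q n = (q powr (n/2) - 1 / q powr (n/2)) / (q powr (1/2) - 1 / q powr (1/2))"
    "aw_gamma q (n + 1) = (q powr (n/2) * q powr (1/2) - 1 / (q powr (n/2) * q powr (1/2)))
       / (q powr (1/2) - 1 / q powr (1/2))"
    "aw_gamma q (n - 1) = (q powr (n/2) / q powr (1/2) - q powr (1/2) / q powr (n/2))
       / (q powr (1/2) - 1 / q powr (1/2))"
  using assms
  by (simp_all add: aw_alpha_def aw_gamma_def add_divide_distrib diff_divide_distrib
      powr_add powr_diff powr_minus_divide minus_divide_left[symmetric])

text \<open>The numbers q^(1/2) and q^(-1/2) have sum 2 \<alpha> and product 1, so their n-th powers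
  solve this recurrence.\<close>

lemma aw_alpha_rec:
  assumes "0 < q"
  shows "aw_alpha q (n + 1) = 2 * aw_alpha q 1 * aw_alpha q n - aw_alpha q (n - 1)"
proof -
  define t where "t = q powr (n / 2)"
  define p where "p = q powr (1 / 2)"
  have "p > 0" "t > 0" using assms by (auto simp: t_def p_def)
  thus ?thesis
    unfolding aw_values(1)[OF assms] aw_values(2-7)[OF assms, of n] t_def[symmetric] p_def[symmetric]
    by (simp add: field_simps)
qed

lemma aw_gamma_rec:
  assumes "0 < q"
  shows "aw_gamma q (n + 1) = 2 * aw_alpha q 1 * aw_gamma q n - aw_gamma q (n - 1)"
proof -
  define t where "t = q powr (n / 2)"
  define p where "p = q powr (1 / 2)"
  define k where "k = p - 1 / p"
  have "p > 0" "t > 0" using assms by (auto simp: t_def p_def)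
  hence "t * p - 1 / (t * p) = 2 * ((p + 1 / p) / 2) * (t - 1 / t) - (t / p - p / t)"
    by (simp add: field_simps)
  from arg_cong[OF this, of "\<lambda>y. y / k"] show ?thesis
    unfolding aw_values(1)[OF assms] aw_values(2-7)[OF assms, of n] t_def[symmetric] p_def[symmetric]
      k_def[symmetric] by (simp only: times_divide_eq_right diff_divide_distrib[symmetric])
qed

text \<open>With k = q^(1/2) - q^(-1/2), \<alpha>^2 - 1 = k^2/4 absorbs the denominator of \<gamma>.
  Together with \<open>aw_gamma_diff\<close> this brings the coefficients of \<phi> into the form A
  y_n - y_(n-1) for y = d, e.\<close>

lemma aw_alpha_diff:
  assumes "0 < q" "q < 1"
  shows "(aw_alpha q 1 ^ 2 - 1) * aw_gamma q n = aw_alpha q 1 * aw_alpha q n - aw_alpha q (n - 1)"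
proof -
  define t where "t = q powr (n / 2)"
  define p where "p = q powr (1 / 2)"
  define k where "k = p - 1 / p"
  have pt: "p > 0" "t > 0" using assms by (auto simp: t_def p_def)
  have k0: "k \<noteq> 0"
    using powr_half_less[OF assms] by (simp add: k_def p_def powr_minus_divide)
  have *: "((p + 1 / p) / 2)\<^sup>2 - 1 = k\<^sup>2 / 4"
    using pt by (simp add: k_def field_simps power2_eq_square)
  have "(((p + 1 / p) / 2)\<^sup>2 - 1) * ((t - 1 / t) / k) = k * (t - 1 / t) / 4"
    unfolding * using k0 by (simp add: power2_eq_square)
  also have "\<dots> = (p + 1 / p) / 2 * ((t + 1 / t) / 2) - (t / p + p / t) / 2"
    using pt by (simp add: k_def field_simps)
  finally show ?thesis
    unfolding aw_values(1)[OF assms(1)] aw_values(2-7)[OF assms(1), of n] t_def[symmetric]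
      p_def[symmetric] k_def[symmetric] .
qed

lemma aw_gamma_diff:
  assumes "0 < q" "q < 1"
  shows "aw_alpha q n = aw_alpha q 1 * aw_gamma q n - aw_gamma q (n - 1)"
proof -
  define t where "t = q powr (n / 2)"
  define p where "p = q powr (1 / 2)"
  define k where "k = p - 1 / p"
  have pt: "p > 0" "t > 0" using assms by (auto simp: t_def p_def)
  have k0: "k \<noteq> 0"
    using powr_half_less[OF assms] by (simp add: k_def p_def powr_minus_divide)
  have "(t + 1 / t) / 2 * k = (p + 1 / p) / 2 * (t - 1 / t) - (t / p - p / t)"
    using pt by (simp add: k_def field_simps)
  hence "(t + 1 / t) / 2 = ((p + 1 / p) / 2 * (t - 1 / t) - (t / p - p / t)) / k"
    using k0 by (metis nonzero_eq_divide_eq)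
  also have "\<dots> = (p + 1 / p) / 2 * ((t - 1 / t) / k) - (t / p - p / t) / k"
    by (simp only: times_divide_eq_right diff_divide_distrib[symmetric])
  finally show ?thesis
    unfolding aw_values(1)[OF assms(1)] aw_values(2-7)[OF assms(1), of n] t_def[symmetric]
      p_def[symmetric] k_def[symmetric] .
qed

section \<open>The recurrence for the derived polynomials\<close>

text \<open>Each of the four parenthesised coefficients on the right is one of the identities
  \<open>coefficient_1\<close>, ..., \<open>coefficient_4\<close> below and vanishes. The coefficient of \<open>r4\<close> on the left is
  \<open>\<gamma>\<^sub>n\<^sub>+\<^sub>2\<close>, rewritten by its recurrence.\<close>

lemma fourth_order_identity:
  fixes A x :: complex
  assumes "r2 = (x - \<beta>0) * r1 - \<zeta>0 * r0" "r3 = (x - \<beta>1) * r2 - \<zeta>1 * r1"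
    "r4 = (x - \<beta>2) * r3 - \<zeta>2 * r2"
  shows "(2 * A * g3 - g2) * r4 + (b3 + b2 - 2 * A * x) * (g3 * r3)
     + (c3 + c2 + b2 ^ 2 - 2 * A * x * b2 + x\<^sup>2 + A\<^sup>2 - 1) * (g2 * r2)
     + c2 * (b2 + b1 - 2 * A * x) * (g1 * r1) + c2 * c1 * (g0 * r0)
   = ((b3 + b2 - 2 * A * \<beta>2) * g3 + g2 * (\<beta>2 + \<beta>1 - 2 * A * b2)) * r3
   + (- 2 * A * \<zeta>2 * g3 + g2 * (c3 + c2 + b2 ^ 2 - 2 * A * b2 * \<beta>1 + \<beta>1 ^ 2 + \<zeta>2 + \<zeta>1 + A\<^sup>2 - 1)
       - 2 * A * c2 * g1) * r2
   + (g2 * \<zeta>1 * (\<beta>1 + \<beta>0 - 2 * A * b2) + c2 * g1 * (b2 + b1 - 2 * A * \<beta>0)) * r1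
   + (g2 * \<zeta>1 * \<zeta>0 - 2 * A * c2 * g1 * \<zeta>0 + c2 * c1 * g0) * r0"
  unfolding assms(3) assms(2) assms(1) by (simp add: power2_eq_square algebra_simps)

text \<open>What the coefficient identities rest on: \<gamma>, d, e solve the same second-order
  recurrence, and \<phi> is built from d, e and a constant c independent of n. B 0 and C 1 are
  listed separately because of the conventions at n = 0.\<close>

locale askey_wilson_recurrence =
  fixes A :: complex and \<gamma> d e :: "int \<Rightarrow> complex" and c :: complex and \<phi> :: "nat \<Rightarrow> complex \<Rightarrow> complex"
    and B C :: "nat \<Rightarrow> complex"
  assumes \<gamma>_rec: "\<And>n. \<gamma> (n + 1) = 2 * A * \<gamma> n - \<gamma> (n - 1)"
    and d_rec: "\<And>n. d (n + 1) = 2 * A * d n - d (n - 1)"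
    and e_rec: "\<And>n. e (n + 1) = 2 * A * e n - e (n - 1)"
    and \<gamma>_0: "\<gamma> 0 = 0" and \<gamma>_1: "\<gamma> 1 = 1"
    and \<gamma>_nz: "\<And>n::nat. \<gamma> (int n + 1) \<noteq> 0"
    and d_even: "\<And>n::nat. d (2 * int n) \<noteq> 0" and d_odd: "\<And>n::nat. d (2 * int n + 1) \<noteq> 0"
    and \<phi>: "\<And>n z. \<phi> n z = (A * d (2 * int n) - d (2 * int n - 1)) * (z\<^sup>2 - 1 / 2)
                - (A * e (int n) - e (int n - 1)) * z + c"
    and B_0: "B 0 = e 0 / d 0"
    and B_Suc: "\<And>n. B (n + 1) = \<gamma> (int n + 2) * (e (int n + 1) / d (2 * int n + 2))
                - \<gamma> (int n + 1) * (e (int n) / d (2 * int n))"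
    and C_1: "C 1 = - \<phi> 0 (e 0 / d 0) / d 1"
    and C_Suc: "\<And>n. C (n + 2) = - \<gamma> (int n + 2) * d (int n) *
                \<phi> (n + 1) (e (int n + 1) / d (2 * int n + 2)) / (d (2 * int n + 1) * d (2 * int n + 3))"
    and C_nz: "\<And>n. C (n + 1) \<noteq> 0"
begin

section \<open>Recurrence data of the derived sequence and relations among them\<close>

definition \<sigma> :: "nat \<Rightarrow> complex" where
  "\<sigma> n = e (int n) / d (2 * int n)"

definition \<beta> :: "nat \<Rightarrow> complex" where
  "\<beta> n = \<gamma> (int n + 1) * \<sigma> (n + 1) - \<gamma> (int n) * \<sigma> n"

text \<open>The factor shared by \<open>C (n + 2)\<close> and \<open>\<zeta> (n + 1)\<close>; it
  gives \<zeta> without dividing by d.\<close>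

definition F :: "nat \<Rightarrow> complex" where
  "F n = - \<phi> (n + 1) (\<sigma> (n + 1)) / (d (2 * int n + 1) * d (2 * int n + 3))"

text \<open>The value 0 at n = 0 lets the second and fourth coefficient identities start at n =
  0.\<close>

definition \<zeta> :: "nat \<Rightarrow> complex" where
  "\<zeta> n = (if n = 0 then 0 else \<gamma> (int n) * d (int n) * F (n - 1))"

lemma \<zeta>_0: "\<zeta> 0 = 0" and \<zeta>_Suc: "\<zeta> (n + 1) = \<gamma> (int n + 1) * d (int n + 1) * F n"
  by (simp_all add: \<zeta>_def algebra_simps)

lemma C_F: "C (n + 2) = \<gamma> (int n + 2) * d (int n) * F n"
  unfolding C_Suc F_def \<sigma>_def by (simp add: algebra_simps)

lemma \<zeta>_nz: "\<zeta> (n + 1) \<noteq> 0"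
proof -
  \<comment> \<open>A nonzero product has nonzero factors: index n supplies \<open>F n\<close>,
    index n + 1 supplies \<open>d (int n + 1)\<close>.\<close>
  have "d (int n) \<noteq> 0 \<and> F n \<noteq> 0" for n
    using C_nz[of "n + 1"] C_F[of n] by auto
  from this[of n] this[of "n + 1"] show ?thesis
    using \<gamma>_nz[of n] unfolding \<zeta>_Suc by (simp add: add.commute)
qed

text \<open>An addition formula: as functions of n both sides solve the common recurrence, and they
  agree at n = 0, 1. It expands d at doubled indices.\<close>

lemma d_gamma: "d m * \<gamma> (int n + 1) - d (m - 1) * \<gamma> (int n) = d (m + int n)"
proof (induction n rule: induct_nat_012)
  case 1
  show ?case using \<gamma>_rec[of 1] d_rec[of m] by (simp add: \<gamma>_0 \<gamma>_1)
next
  case (ge2 n)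
  have "\<gamma> (int n + 3) = 2 * A * \<gamma> (int n + 2) - \<gamma> (int n + 1)"
       "\<gamma> (int n + 2) = 2 * A * \<gamma> (int n + 1) - \<gamma> (int n)"
       "d (m + int n + 2) = 2 * A * d (m + int n + 1) - d (m + int n)"
    using \<gamma>_rec[of "int n + 2"] \<gamma>_rec[of "int n + 1"] d_rec[of "m + int n + 1"]
    by (simp_all add: algebra_simps)
  moreover have "d m * \<gamma> (int n + 1) - d (m - 1) * \<gamma> (int n) = d (m + int n)"
    "d m * \<gamma> (int n + 2) - d (m - 1) * \<gamma> (int n + 1) = d (m + int n + 1)"
    using ge2 by (simp_all add: algebra_simps)
  ultimately have "d m * \<gamma> (int n + 3) - d (m - 1) * \<gamma> (int n + 2) = d (m + int n + 2)"
    by algebra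
  thus ?case by (simp add: algebra_simps)
qed (simp add: \<gamma>_0 \<gamma>_1)

text \<open>The form X^2 + Y^2 - 2 A X Y is invariant under (X, Y) -> (Y, 2 A Y - X), and it is 1 at
  the initial pair (0, 1).\<close>

lemma gamma_casorati: "\<gamma> (int n + 1) ^ 2 + \<gamma> (int n) ^ 2 - 2 * A * \<gamma> (int n) * \<gamma> (int n + 1) = 1"
proof (induction n)
  case (Suc n)
  have "\<gamma> (int n + 2) = 2 * A * \<gamma> (int n + 1) - \<gamma> (int n)"
    using \<gamma>_rec[of "int n + 1"] by (simp add: algebra_simps)
  with Suc have "\<gamma> (int n + 2) ^ 2 + \<gamma> (int n + 1) ^ 2 - 2 * A * \<gamma> (int n + 1) * \<gamma> (int n + 2) = 1"
    by algebra
  thus ?case by (simp add: algebra_simps)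
qed (simp add: \<gamma>_0 \<gamma>_1)

section \<open>The four coefficient identities\<close>

lemma B_\<sigma>: "B (n + 1) = \<gamma> (int n + 2) * \<sigma> (n + 1) - \<gamma> (int n + 1) * \<sigma> n" "B 0 = \<sigma> 0"
  unfolding B_Suc \<sigma>_def B_0 by (simp_all add: algebra_simps)

text \<open>Linear in three consecutive \<sigma>; each of their coefficients cancels by the
  recurrence for \<gamma>.\<close>

lemma coefficient_1:
  "(B (n + 2) + B (n + 1) - 2 * A * \<beta> (n + 1)) * \<gamma> (int n + 2)
     + \<gamma> (int n + 1) * (\<beta> (n + 1) + \<beta> n - 2 * A * B (n + 1)) = 0"
proof -
  have g: "\<gamma> (int n + 2) = 2 * A * \<gamma> (int n + 1) - \<gamma> (int n)"
    "\<gamma> (int n + 3) = 2 * A * \<gamma> (int n + 2) - \<gamma> (int n + 1)"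
    using \<gamma>_rec[of "int n + 1"] \<gamma>_rec[of "int n + 2"] by (simp_all add: algebra_simps)
  have "B (n + 2) = \<gamma> (int n + 3) * \<sigma> (n + 2) - \<gamma> (int n + 2) * \<sigma> (n + 1)"
    using B_\<sigma>(1)[of "n + 1"] by (simp add: algebra_simps)
  moreover have "\<beta> (n + 1) = \<gamma> (int n + 2) * \<sigma> (n + 2) - \<gamma> (int n + 1) * \<sigma> (n + 1)"
    by (simp add: \<beta>_def algebra_simps)
  ultimately show ?thesis
    unfolding B_\<sigma>(1)[of n] \<beta>_def[of n] g by algebra
qed

text \<open>Substituting e_n = d_(2n) \<sigma>_n makes the linear term of \<phi> quadratic in
  \<sigma>. The constant c cancels, and d_(2n) + d_(2n+2) = 2 A d_(2n+1) lets d_(2n+1) factor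
  out.\<close>

lemma phi_diff:
  "\<phi> (n + 1) (\<sigma> (n + 1)) - \<phi> n (\<sigma> n)
   + d (2 * int n + 1) * (\<sigma> (n + 1) ^ 2 + \<sigma> n ^ 2 - 2 * A * \<sigma> n * \<sigma> (n + 1) + A\<^sup>2 - 1) = 0"
proof -
  have s: "e (int n) = d (2 * int n) * \<sigma> n" "e (int n + 1) = d (2 * int n + 2) * \<sigma> (n + 1)"
    using d_even[of n] d_even[of "n + 1"] by (simp_all add: \<sigma>_def algebra_simps)
  have d2: "d (2 * int n + 2) = 2 * A * d (2 * int n + 1) - d (2 * int n)"
    "d (2 * int n - 1) = 2 * A * d (2 * int n) - d (2 * int n + 1)"
    using d_rec[of "2 * int n + 1"] d_rec[of "2 * int n"] by (simp_all add: algebra_simps)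
  have e2: "e (int n - 1) = 2 * A * e (int n) - e (int n + 1)"
    using e_rec[of "int n"] by simp
  have p: "\<phi> (n + 1) (\<sigma> (n + 1)) = (A * d (2 * int n + 2) - d (2 * int n + 1)) * (\<sigma> (n + 1) ^ 2 - 1 / 2)
                - (A * e (int n + 1) - e (int n)) * \<sigma> (n + 1) + c"
    unfolding \<phi> by (simp add: algebra_simps)
  show ?thesis
    unfolding p \<phi>[of n] e2 s d2 by (simp add: field_simps power2_eq_square)
qed

text \<open>The terms with \<open>C (n + 2)\<close>, \<open>\<zeta> (n + 1)\<close> and those with
  \<open>C (n + 1)\<close>, \<open>\<zeta> n\<close> each reduce to a multiple of a value of \<phi>;
  their sum cancels the quadratic remainder by \<open>phi_diff\<close>.\<close>

lemma coefficient_2: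
  "- 2 * A * \<zeta> (n + 1) * \<gamma> (int n + 2)
     + \<gamma> (int n + 1) * (C (n + 2) + C (n + 1) + B (n + 1) ^ 2 - 2 * A * B (n + 1) * \<beta> n
         + \<beta> n ^ 2 + \<zeta> (n + 1) + \<zeta> n + A\<^sup>2 - 1)
     - 2 * A * C (n + 1) * \<gamma> (int n) = 0"
proof -
  let ?g0 = "\<gamma> (int n)" and ?g1 = "\<gamma> (int n + 1)"
  have g: "\<gamma> (int n + 2) = 2 * A * ?g1 - ?g0"
    using \<gamma>_rec[of "int n + 1"] by (simp add: algebra_simps)
  have dn: "d (int n) = 2 * A * d (int n + 1) - d (int n + 2)"
    using d_rec[of "int n + 1"] by (simp add: algebra_simps)
  have quad: "B (n + 1) ^ 2 - 2 * A * B (n + 1) * \<beta> n + \<beta> n ^ 2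
      = \<sigma> (n + 1) ^ 2 + \<sigma> n ^ 2 - 2 * A * \<sigma> n * \<sigma> (n + 1)"
  proof -
    \<comment> \<open>The linear map from the \<sigma> pair to (B, \<beta>) multiplies the quadratic
      form by the invariant of \<open>gamma_casorati\<close>.\<close>
    have "B (n + 1) ^ 2 - 2 * A * B (n + 1) * \<beta> n + \<beta> n ^ 2
        = (?g1 ^ 2 + ?g0 ^ 2 - 2 * A * ?g0 * ?g1) * (\<sigma> (n + 1) ^ 2 + \<sigma> n ^ 2 - 2 * A * \<sigma> n * \<sigma> (n + 1))"
      unfolding B_\<sigma> \<beta>_def g by (simp add: power2_eq_square algebra_simps)
    thus ?thesis by (simp add: gamma_casorati)
  qed
  have d3: "d (2 * int n + 3) = d (int n + 2) * \<gamma> (int n + 2) - d (int n + 1) * ?g1"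
    using d_gamma[of "int n + 2" "n + 1"] by (simp add: algebra_simps)
  have new: "?g1 * (C (n + 2) + \<zeta> (n + 1)) - 2 * A * \<zeta> (n + 1) * \<gamma> (int n + 2)
      = - ?g1 * d (2 * int n + 3) * F n"
    unfolding C_F \<zeta>_Suc dn d3 g by (simp add: algebra_simps)
  have "d (2 * int n + 1) \<noteq> 0" "d (2 * int n + 3) \<noteq> 0"
    using d_odd[of n] d_odd[of "n + 1"] by (simp_all add: algebra_simps)
  hence FF: "d (2 * int n + 3) * F n = - \<phi> (n + 1) (\<sigma> (n + 1)) / d (2 * int n + 1)"
    by (simp add: F_def)
  \<comment> \<open>The previous index of the same computation; \<open>C_F\<close> starts at C 2, so
    n = 0 rests on the formula for C 1.\<close>
  have old: "?g1 * (C (n + 1) + \<zeta> n) - 2 * A * C (n + 1) * ?g0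
      = - ?g1 * \<phi> n (\<sigma> n) / d (2 * int n + 1)"
  proof (cases n)
    case 0
    thus ?thesis using C_1 by (simp add: \<gamma>_0 \<gamma>_1 \<zeta>_0 \<sigma>_def)
  next
    case (Suc m)
    have g': "\<gamma> (int m + 2) = 2 * A * \<gamma> (int m + 1) - \<gamma> (int m)"
      using \<gamma>_rec[of "int m + 1"] by (simp add: algebra_simps)
    have d1: "d (2 * int m + 1) = d (int m + 1) * \<gamma> (int m + 1) - d (int m) * \<gamma> (int m)"
      using d_gamma[of "int m + 1" m] by (simp add: algebra_simps)
    have "\<gamma> (int m + 2) * (C (m + 2) + \<zeta> (m + 1)) - 2 * A * C (m + 2) * \<gamma> (int m + 1)
      = \<gamma> (int m + 2) * (d (2 * int m + 1) * F m)"
      unfolding C_F \<zeta>_Suc d1 g' by (simp add: algebra_simps)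
    also have "d (2 * int m + 1) * F m = - \<phi> (m + 1) (\<sigma> (m + 1)) / d (2 * int m + 3)"
      using d_odd[of m] by (simp add: F_def)
    finally have "\<gamma> (int m + 2) * (C (m + 2) + \<zeta> (m + 1)) - 2 * A * C (m + 2) * \<gamma> (int m + 1)
      = - \<gamma> (int m + 2) * (\<phi> (m + 1) (\<sigma> (m + 1)) / d (2 * int m + 3))"
      by simp
    thus ?thesis using Suc by (simp add: algebra_simps)
  qed
  have ph: "\<sigma> (n + 1) ^ 2 + \<sigma> n ^ 2 - 2 * A * \<sigma> n * \<sigma> (n + 1) + A\<^sup>2 - 1
      = (\<phi> n (\<sigma> n) - \<phi> (n + 1) (\<sigma> (n + 1))) / d (2 * int n + 1)"
    using phi_diff[of n] d_odd[of n] by (simp add: field_simps)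
  have "- 2 * A * \<zeta> (n + 1) * \<gamma> (int n + 2)
     + ?g1 * (C (n + 2) + C (n + 1) + B (n + 1) ^ 2 - 2 * A * B (n + 1) * \<beta> n
         + \<beta> n ^ 2 + \<zeta> (n + 1) + \<zeta> n + A\<^sup>2 - 1)
     - 2 * A * C (n + 1) * ?g0
    = (?g1 * (C (n + 2) + \<zeta> (n + 1)) - 2 * A * \<zeta> (n + 1) * \<gamma> (int n + 2))
      + (?g1 * (C (n + 1) + \<zeta> n) - 2 * A * C (n + 1) * ?g0)
      + ?g1 * ((B (n + 1) ^ 2 - 2 * A * B (n + 1) * \<beta> n + \<beta> n ^ 2) + A\<^sup>2 - 1)"
    by (simp add: algebra_simps)
  also have "\<dots> = - ?g1 * (d (2 * int n + 3) * F n) - ?g1 * \<phi> n (\<sigma> n) / d (2 * int n + 1)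
      + ?g1 * ((\<phi> n (\<sigma> n) - \<phi> (n + 1) (\<sigma> (n + 1))) / d (2 * int n + 1))"
    unfolding new old quad ph by simp
  also have "\<dots> = 0"
    unfolding FF by (simp add: diff_divide_distrib algebra_simps)
  finally show ?thesis .
qed

text \<open>Both products share \<open>F n\<close> and two values of \<gamma>; what remains is the
  recurrence for e.\<close>

lemma coefficient_3:
  "\<gamma> (int n + 2) * \<zeta> (n + 1) * (\<beta> (n + 1) + \<beta> n - 2 * A * B (n + 2))
     + C (n + 2) * \<gamma> (int n + 1) * (B (n + 2) + B (n + 1) - 2 * A * \<beta> n) = 0"
proof -
  let ?g0 = "\<gamma> (int n)" and ?g1 = "\<gamma> (int n + 1)" and ?d0 = "d (int n)" and ?d1 = "d (int n + 1)"
  have g: "\<gamma> (int n + 2) = 2 * A * ?g1 - ?g0" "\<gamma> (int n + 3) = 2 * A * \<gamma> (int n + 2) - ?g1"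
    using \<gamma>_rec[of "int n + 1"] \<gamma>_rec[of "int n + 2"] by (simp_all add: algebra_simps)
  have s: "e (int n) = d (2 * int n) * \<sigma> n" "e (int n + 1) = d (2 * int n + 2) * \<sigma> (n + 1)"
    "e (int n + 2) = d (2 * int n + 4) * \<sigma> (n + 2)"
    using d_even[of n] d_even[of "n + 1"] d_even[of "n + 2"] by (simp_all add: \<sigma>_def algebra_simps)
  have er: "e (int n + 2) = 2 * A * e (int n + 1) - e (int n)"
    using e_rec[of "int n + 1"] by (simp add: algebra_simps)
  have B2: "B (n + 2) = \<gamma> (int n + 3) * \<sigma> (n + 2) - \<gamma> (int n + 2) * \<sigma> (n + 1)"
    using B_\<sigma>(1)[of "n + 1"] by (simp add: algebra_simps)
  have \<beta>1: "\<beta> (n + 1) = \<gamma> (int n + 2) * \<sigma> (n + 2) - ?g1 * \<sigma> (n + 1)"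
    by (simp add: \<beta>_def algebra_simps)
  have "d (int n - 1) = 2 * A * ?d0 - ?d1"
    using d_rec[of "int n"] by (simp add: algebra_simps)
  note d1 = this
  \<comment> \<open>The doubled indices are reduced to d_n and d_(n+1), so the next identity is
    polynomial in these, \<gamma>, \<sigma> and A.\<close>
  have D: "d (2 * int n) = ?d0 * ?g1 - (2 * A * ?d0 - ?d1) * ?g0"
    "d (2 * int n + 2) = ?d1 * \<gamma> (int n + 2) - ?d0 * ?g1"
    "d (2 * int n + 4) = ?d1 * \<gamma> (int n + 2 + 2) - ?d0 * \<gamma> (int n + 3)"
    using d_gamma[of "int n" n] d_gamma[of "int n + 1" "n + 1"] d_gamma[of "int n + 1" "n + 3"]
    unfolding d1 by (simp_all add: algebra_simps)
  have g4: "\<gamma> (int n + 2 + 2) = 2 * A * \<gamma> (int n + 3) - \<gamma> (int n + 2)"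
    using \<gamma>_rec[of "int n + 3"] by (simp add: algebra_simps)
  have "?d1 * (\<beta> (n + 1) + \<beta> n - 2 * A * B (n + 2)) + ?d0 * (B (n + 2) + B (n + 1) - 2 * A * \<beta> n)
      = - (e (int n + 2) - 2 * A * e (int n + 1) + e (int n))"
    unfolding s D B2 \<beta>1 B_\<sigma>(1)[of n] \<beta>_def[of n] g4 g by (simp add: algebra_simps)
  also have "\<dots> = 0" using er by simp
  finally show ?thesis
    unfolding C_F \<zeta>_Suc by algebra
qed

text \<open>For n > 0, after the common factors are removed, the recurrence for d is left.\<close>

lemma coefficient_4:
  "\<gamma> (int n + 2) * \<zeta> (n + 1) * \<zeta> n - 2 * A * C (n + 2) * \<gamma> (int n + 1) * \<zeta> n
     + C (n + 2) * C (n + 1) * \<gamma> (int n) = 0"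
proof (cases n)
  case 0
  thus ?thesis by (simp add: \<gamma>_0 \<zeta>_0)
next
  case (Suc m)
  have d: "d (int m + 2) = 2 * A * d (int m + 1) - d (int m)"
    using d_rec[of "int m + 1"] by (simp add: algebra_simps)
  have "\<zeta> (m + 2) = \<gamma> (int m + 2) * d (int m + 2) * F (m + 1)"
    "C (m + 3) = \<gamma> (int m + 3) * d (int m + 1) * F (m + 1)"
    using \<zeta>_Suc[of "m + 1"] C_F[of "m + 1"] by (simp_all add: algebra_simps numeral_3_eq_3)
  hence "\<gamma> (int m + 3) * \<zeta> (m + 2) * \<zeta> (m + 1) - 2 * A * C (m + 3) * \<gamma> (int m + 2) * \<zeta> (m + 1)
     + C (m + 3) * C (m + 2) * \<gamma> (int m + 1) = 0"
    unfolding C_F \<zeta>_Suc d by algebra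
  thus ?thesis using Suc by (simp add: algebra_simps numeral_3_eq_3)
qed

text \<open>Here v n stands for the value of D P_n at x, and r (n + 1) for that of R_n. Both sides
  satisfy one fourth-order recurrence with the same start; the equation for \<open>v 3\<close> is
  that recurrence one index earlier, with \<open>v 0 = 0\<close>.\<close>

lemma fourth_order_solution:
  fixes v r :: "nat \<Rightarrow> complex" and x :: complex
  assumes v: "v 0 = 0" "v 1 = 1" "v 2 = 2 * A * x - B 1 - B 0"
      "v 3 + (B 2 + B 1 - 2 * A * x) * v 2
         + (C 2 + C 1 + B 1 ^ 2 - 2 * A * x * B 1 + x\<^sup>2 + A\<^sup>2 - 1) = 0"
      "\<And>n. v (n + 4) + (B (n + 3) + B (n + 2) - 2 * A * x) * v (n + 3)
         + (C (n + 3) + C (n + 2) + B (n + 2) ^ 2 - 2 * A * x * B (n + 2) + x\<^sup>2 + A\<^sup>2 - 1) * v (n + 2)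
         + C (n + 2) * (B (n + 2) + B (n + 1) - 2 * A * x) * v (n + 1)
         + C (n + 2) * C (n + 1) * v n = 0"
    and r: "r 0 = 0" "r 1 = 1" "\<And>n. r (n + 2) = (x - \<beta> n) * r (n + 1) - \<zeta> n * r n"
  shows "v n = \<gamma> (int n) * r n"
proof (induction n rule: less_induct)
  case (less n)
  have g2: "\<gamma> 2 = 2 * A" and g3: "\<gamma> 3 = 2 * A * \<gamma> 2 - 1"
    using \<gamma>_rec[of 1] \<gamma>_rec[of 2] by (simp_all add: \<gamma>_0 \<gamma>_1)
  have r2: "r 2 = x - \<beta> 0" and r3: "r 3 = (x - \<beta> 1) * r 2 - \<zeta> 1"
    using r(3)[of 0] r(3)[of 1] r(1,2) by (simp_all add: numeral_2_eq_2 numeral_3_eq_3)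
  have B01: "B 1 + B 0 = 2 * A * \<beta> 0"
    using B_\<sigma>(1)[of 0] by (simp add: B_\<sigma>(2) \<beta>_def g2 \<gamma>_0 \<gamma>_1)
  consider "n = 0" | "n = 1" | "n = 2" | "n = 3" | m where "n = m + 4"
  proof (cases "n < 4")
    case False
    thus ?thesis using that(5)[of "n - 4"] by simp
  qed (use that in \<open>auto simp: less_Suc_eq numeral_eq_Suc\<close>)
  thus ?case
  proof cases
    case 2
    thus ?thesis using v(2) r(2) by (simp add: \<gamma>_1)
  next
    case 3
    have "v 2 = \<gamma> 2 * r 2" unfolding v g2 r2 using B01 by (simp add: algebra_simps)
    thus ?thesis using 3 by simp
  next
    case 4
    have "v 2 = \<gamma> 2 * r 2" unfolding v g2 r2 using B01 by (simp add: algebra_simps)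
    \<comment> \<open>Since \<open>r 0 = 0\<close>, only the first two coefficient identities, at
      index 0, enter here.\<close>
    moreover have "(B 2 + B 1 - 2 * A * \<beta> 1) * \<gamma> 2 + (\<beta> 1 + \<beta> 0 - 2 * A * B 1) = 0"
      using coefficient_1[of 0] by (simp add: \<gamma>_1 numeral_2_eq_2)
    moreover have "- 2 * A * \<zeta> 1 * \<gamma> 2 + (C 2 + C 1 + B 1 ^ 2 - 2 * A * B 1 * \<beta> 0
         + \<beta> 0 ^ 2 + \<zeta> 1 + A\<^sup>2 - 1) = 0"
      using coefficient_2[of 0] by (simp add: \<gamma>_1 \<gamma>_0 \<zeta>_0 numeral_2_eq_2)
    ultimately have "v 3 = \<gamma> 3 * r 3"
      using v(4) unfolding r3 r2 g3 by algebra
    thus ?thesis using 4 by simp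
  next
    case (5 m)
    let ?g0 = "\<gamma> (int m)" and ?g1 = "\<gamma> (int m + 1)" and ?g2 = "\<gamma> (int m + 2)" and ?g3 = "\<gamma> (int m + 3)"
    have IH: "v m = ?g0 * r m" "v (m + 1) = ?g1 * r (m + 1)" "v (m + 2) = ?g2 * r (m + 2)"
      "v (m + 3) = ?g3 * r (m + 3)"
      using less[of m] less[of "m + 1"] less[of "m + 2"] less[of "m + 3"] 5
      by (simp_all add: algebra_simps)
    have g4: "\<gamma> (int m + 4) = 2 * A * ?g3 - ?g2"
      using \<gamma>_rec[of "int m + 3"] by (simp add: algebra_simps)
    have k: "m + 1 + 1 = m + 2" "m + 1 + 2 = m + 3" "m + 2 + 1 = m + 3" "m + 2 + 2 = m + 4"
      "int (m + 1) = int m + 1" "int m + 1 + 1 = int m + 2" "int m + 1 + 2 = int m + 3"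
      by simp_all
    note r' = r(3)[of m] r(3)[of "m + 1", unfolded k] r(3)[of "m + 2", unfolded k]
    note c1 = coefficient_1[of "m + 1", unfolded k] and c2 = coefficient_2[of "m + 1", unfolded k]
      and c3 = coefficient_3[of m] and c4 = coefficient_4[of m]
    note I = fourth_order_identity[OF r', of A ?g3 ?g2 "B (m + 3)" "B (m + 2)"
          "C (m + 3)" "C (m + 2)" "B (m + 1)" ?g1 "C (m + 1)" ?g0, folded g4, unfolded c1 c2 c3 c4]
    \<comment> \<open>The recurrence for v and the identity for \<gamma> r both sum to 0 and share
      all terms except the leading one.\<close>
    have "v (m + 4) = \<gamma> (int m + 4) * r (m + 4)"
      using trans[OF v(5)[of m, unfolded IH] I[unfolded mult_zero_left add_0_left, symmetric]]
      by (simp only: add_right_cancel)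
    thus ?thesis using 5 by (simp add: algebra_simps)
  qed (simp_all add: v r \<gamma>_0 \<gamma>_1)
qed

end

section \<open>Transfer to the Askey-Wilson operator\<close>

theorem theorem3p5:
  fixes q \<alpha> :: real
    and B\<^sub>0 B\<^sub>1 C\<^sub>1 C\<^sub>2 a b :: complex
    and d e :: "int \<Rightarrow> complex"
    and \<phi> :: "nat \<Rightarrow> complex \<Rightarrow> complex"
    and B C :: "nat \<Rightarrow> complex"
    and P :: "nat \<Rightarrow> complex poly"
  assumes q: "0 < q" "q < 1"
    and \<alpha>: "\<alpha> = (q powr (1/2) + q powr (-1/2)) / 2"
    and a: "a = of_real (\<alpha> * (3 - 4 * \<alpha>\<^sup>2) / (4 * \<alpha>\<^sup>2 - 1))
                + ((B\<^sub>0 + B\<^sub>1)\<^sup>2 + 4 * of_real \<alpha> ^ 2 * (C\<^sub>1 - B\<^sub>0 * B\<^sub>1 + of_real \<alpha> ^ 2 - 1))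
                  / (2 * of_real \<alpha> * (4 * of_real \<alpha> ^ 2 - 1) * C\<^sub>2)"
    and b: "b = (a + of_real \<alpha>) * B\<^sub>1 - (B\<^sub>0 + B\<^sub>1) / (2 * of_real \<alpha>)"
    and d: "\<And>n. d n = a * of_real (aw_gamma q n) + of_real (aw_alpha q n)"
    and e: "\<And>n. e n = (b + a * B\<^sub>0) * of_real (aw_gamma q n) + B\<^sub>0 * of_real (aw_alpha q n)"
    and \<phi>: "\<And>n z. \<phi> n z =
              (of_real ((\<alpha>\<^sup>2 - 1) * aw_gamma q (2 * int n)) + a * of_real (aw_alpha q (2 * int n)))
                * (z\<^sup>2 - 1/2)
              - ((b + a * B\<^sub>0) * of_real (aw_alpha q (int n))
                 + of_real (\<alpha>\<^sup>2 - 1) * B\<^sub>0 * of_real (aw_gamma q (int n))) * z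
              + b * B\<^sub>0 - (a + of_real \<alpha>) * C\<^sub>1 + a / 2"
    and C2_nonzero: "C\<^sub>2 \<noteq> 0"
    and denominators_nonzero: "\<And>n :: nat. d (2 * int n) \<noteq> 0" "\<And>n :: nat. d (2 * int n + 1) \<noteq> 0"
    and B: "\<And>n. B n =
              of_real (aw_gamma q (int n + 1)) * e (int n) / d (2 * int n)
              - (if n = 0 then 0
                 else of_real (aw_gamma q (int n)) * e (int n - 1) / d (2 * int n - 2))"
    and C: "\<And>n. C (n + 1) =
              - (of_real (aw_gamma q (int n + 1)) / d (2 * int n + 1))
                * (if n = 0 then 1 else d (int n - 1) / d (2 * int n - 1))
                * \<phi> n (e (int n) / d (2 * int n))"
    and C_nonzero: "\<And>n. n \<ge> 1 \<Longrightarrow> C n \<noteq> 0"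
    and P: "monic_OPS P"
    and recurrence: "\<And>n. [:0, 1:] * P n =
              P (n + 1) + smult (B n) (P n) + (if n = 0 then 0 else smult (C n) (P (n - 1)))"
  shows "classical q P"
proof -
  define A :: complex where "A = of_real \<alpha>"
  define \<gamma> :: "int \<Rightarrow> complex" where "\<gamma> n = of_real (aw_gamma q n)" for n
  define c where "c = b * B\<^sub>0 - (a + of_real \<alpha>) * C\<^sub>1 + a / 2"
  have \<alpha>1: "aw_alpha q 1 = \<alpha>"
    by (simp add: aw_alpha_def \<alpha>)
  \<comment> \<open>The last two relations match the given form of \<phi> with the one in the
    locale.\<close>
  have rec: "of_real (aw_gamma q (n + 1)) = 2 * A * of_real (aw_gamma q n) - of_real (aw_gamma q (n - 1))"
    "of_real (aw_alpha q (n + 1)) = 2 * A * of_real (aw_alpha q n) - of_real (aw_alpha q (n - 1))"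
    "of_real (aw_alpha q n) = A * of_real (aw_gamma q n) - of_real (aw_gamma q (n - 1))"
    "of_real ((\<alpha>\<^sup>2 - 1) * aw_gamma q n) = A * of_real (aw_alpha q n) - of_real (aw_alpha q (n - 1))" for n
    using aw_gamma_rec[of q n] aw_alpha_rec[of q n] aw_gamma_diff[of q n] aw_alpha_diff[of q n] q
    by (simp_all add: \<alpha>1 A_def)
  interpret askey_wilson_recurrence A \<gamma> d e c \<phi> B C
  proof
    show "\<gamma> (n + 1) = 2 * A * \<gamma> n - \<gamma> (n - 1)" for n
      unfolding \<gamma>_def by (rule rec)
    show "d (n + 1) = 2 * A * d n - d (n - 1)" "e (n + 1) = 2 * A * e n - e (n - 1)" for n
      unfolding d e rec(1,2) by (simp_all add: algebra_simps)
    show "\<gamma> 0 = 0" "\<gamma> 1 = 1"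
      using q by (simp_all add: \<gamma>_def aw_gamma_0 aw_gamma_1)
    show "\<gamma> (int n + 1) \<noteq> 0" for n
      using aw_gamma_pos[OF q, of "int n + 1"] by (simp add: \<gamma>_def)
    show "d (2 * int n) \<noteq> 0" "d (2 * int n + 1) \<noteq> 0" for n
      by (rule denominators_nonzero)+
    show "B 0 = e 0 / d 0"
      using B[of 0] q by (simp add: aw_gamma_1)
    show "B (n + 1) = \<gamma> (int n + 2) * (e (int n + 1) / d (2 * int n + 2))
        - \<gamma> (int n + 1) * (e (int n) / d (2 * int n))" for n
      using B[of "n + 1"] by (simp add: \<gamma>_def algebra_simps)
    show "C 1 = - \<phi> 0 (e 0 / d 0) / d 1"
      using C[of 0] q by (simp add: aw_gamma_1)
    show "C (n + 2) = - \<gamma> (int n + 2) * d (int n) *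
        \<phi> (n + 1) (e (int n + 1) / d (2 * int n + 2)) / (d (2 * int n + 1) * d (2 * int n + 3))" for n
      using C[of "n + 1"] by (simp add: \<gamma>_def algebra_simps)
    show "C (n + 1) \<noteq> 0" for n
      by (rule C_nonzero) simp
    show "\<phi> n z = (A * d (2 * int n) - d (2 * int n - 1)) * (z\<^sup>2 - 1 / 2)
        - (A * e (int n) - e (int n - 1)) * z + c" for n z
    proof -
      have k: "A * d m - d (m - 1)
          = of_real ((\<alpha>\<^sup>2 - 1) * aw_gamma q m) + a * of_real (aw_alpha q m)" for m
        unfolding d rec(4) using rec(3)[of m] by algebra
      have l: "A * e m - e (m - 1)
          = (b + a * B\<^sub>0) * of_real (aw_alpha q m) + B\<^sub>0 * of_real ((\<alpha>\<^sup>2 - 1) * aw_gamma q m)" for m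
        unfolding e rec(4) using rec(3)[of m] by algebra
      show ?thesis
        unfolding \<phi> k l by (simp add: c_def algebra_simps)
    qed
  qed
  have "lead_coeff (P 0) = 1" "degree (P 0) = 0"
    using P by (auto simp: monic_OPS_def OPS_def OPS_wrt_def)
  hence P0: "P 0 = 1"
    by (auto elim!: degree_eq_zeroE simp: one_pCons)
  \<comment> \<open>The case distinction supplies the start value 0, since \<open>n - 1\<close> on
    naturals would give \<open>ttr_poly\<close> at 0, which is 1.\<close>
  have *: "poly (askey_wilson q (P n)) x
      = \<gamma> (int n) * (if n = 0 then 0 else poly (ttr_poly \<beta> \<zeta> (n - 1)) x)" for n x
  proof (rule fourth_order_solution)
    \<comment> \<open>Fixing x makes the operator a linear functional, so its five-term recurrence
      is one for complex numbers.\<close>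
    define h where "h f = poly (askey_wilson q f) x" for f
    have h_add: "h (f + g) = h f + h g" and h_smult: "h (smult k f) = k * h f" for f g k
      using q by (simp_all add: h_def askey_wilson_add askey_wilson_smult)
    have h_XX: "h ([:0, 1:] * ([:0, 1:] * f)) = 2 * A * x * h ([:0, 1:] * f) - (A\<^sup>2 - 1 + x\<^sup>2) * h f" for f
      unfolding h_def askey_wilson_X2[OF q A_def[unfolded \<alpha>]]
      by (simp add: power2_eq_square algebra_simps)
    have XP0: "[:0, 1:] * P 0 = P 1 + smult (B 0) (P 0)"
      using recurrence[of 0] by simp
    have XP: "[:0, 1:] * P (n + 1) = P (n + 2) + smult (B (n + 1)) (P (n + 1)) + smult (C (n + 1)) (P n)" for n
      using recurrence[of "n + 1"] by (simp del: mult_pCons_left)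
    have hX0: "h ([:0, 1:] * P 0) = h (P 1) + B 0 * h (P 0)"
      and hX: "h ([:0, 1:] * P (n + 1)) = h (P (n + 2)) + B (n + 1) * h (P (n + 1)) + C (n + 1) * h (P n)" for n
      unfolding XP0 XP by (simp_all only: h_add h_smult)
    have hXX0: "h ([:0, 1:] * ([:0, 1:] * P 0)) = h ([:0, 1:] * P 1) + B 0 * h ([:0, 1:] * P 0)"
      and hXX: "h ([:0, 1:] * ([:0, 1:] * P (n + 1))) = h ([:0, 1:] * P (n + 2))
        + B (n + 1) * h ([:0, 1:] * P (n + 1)) + C (n + 1) * h ([:0, 1:] * P n)" for n
      by (simp_all only: XP0 XP distrib_left mult_smult_right h_add h_smult)
    have h0: "h (P 0) = 0"
      by (simp add: h_def P0 askey_wilson_one)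
    have "h ([:0, 1:] * P 0) = 1"
      using q by (simp add: h_def P0 askey_wilson_X)
    hence h1: "h (P 1) = 1"
      using hX0 h0 by simp
    have X1: "h ([:0, 1:] * P 1) = h (P 2) + B 1 * h (P 1) + C 1 * h (P 0)"
      using hX[of 0] by (simp add: numeral_2_eq_2)
    have X2: "h ([:0, 1:] * P 2) = h (P 3) + B 2 * h (P 2) + C 2 * h (P 1)"
      using hX[of 1] by (simp add: numeral_2_eq_2 numeral_3_eq_3)
    show "h (P 0) = 0" "h (P 1) = 1"
      by (fact h0 h1)+
    show "h (P 2) = 2 * A * x - B 1 - B 0"
      using h_XX[of "P 0"] unfolding hXX0 X1 hX0 h0 h1 by (simp add: algebra_simps)
    have "h ([:0, 1:] * ([:0, 1:] * P 1)) = h ([:0, 1:] * P 2) + B 1 * h ([:0, 1:] * P 1) + C 1 * h ([:0, 1:] * P 0)"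
      using hXX[of 0] by (simp add: numeral_2_eq_2)
    thus "h (P 3) + (B 2 + B 1 - 2 * A * x) * h (P 2)
        + (C 2 + C 1 + B 1 ^ 2 - 2 * A * x * B 1 + x\<^sup>2 + A\<^sup>2 - 1) = 0"
      unfolding h_XX X1 X2 hX0 h0 h1 by (simp add: power2_eq_square algebra_simps)
    show "h (P (n + 4)) + (B (n + 3) + B (n + 2) - 2 * A * x) * h (P (n + 3))
         + (C (n + 3) + C (n + 2) + B (n + 2) ^ 2 - 2 * A * x * B (n + 2) + x\<^sup>2 + A\<^sup>2 - 1) * h (P (n + 2))
         + C (n + 2) * (B (n + 2) + B (n + 1) - 2 * A * x) * h (P (n + 1))
         + C (n + 2) * C (n + 1) * h (P n) = 0" for n
    proof -
      have k: "n + 1 + 1 = n + 2" "n + 1 + 2 = n + 3" "n + 2 + 1 = n + 3" "n + 2 + 2 = n + 4"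
        by simp_all
      \<comment> \<open>The value of \<open>h\<close> at x^2 P_(n+2) is computed in two ways: by the
        quadratic rule \<open>h_XX\<close> and by iterating the three-term recurrence.\<close>
      show ?thesis
        using hXX[of "n + 1", unfolded k]
        unfolding h_XX hX[of n] hX[of "n + 1", unfolded k] hX[of "n + 2", unfolded k]
        by (simp add: power2_eq_square algebra_simps)
    qed
  next
    show "(if n + 2 = 0 then 0 else poly (ttr_poly \<beta> \<zeta> (n + 2 - 1)) x)
        = (x - \<beta> n) * (if n + 1 = 0 then 0 else poly (ttr_poly \<beta> \<zeta> (n + 1 - 1)) x)
          - \<zeta> n * (if n = 0 then 0 else poly (ttr_poly \<beta> \<zeta> (n - 1)) x)" for n
      by (cases n) (simp_all add: algebra_simps)
  qed simp_all
  \<comment> \<open>Agreement at every x gives equality of polynomials.\<close>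
  have "askey_wilson q (P (Suc n)) = smult (\<gamma> (int n + 1)) (ttr_poly \<beta> \<zeta> n)" for n
    using *[of "Suc n"] by (subst poly_eq_poly_eq_iff[symmetric], intro ext) (simp add: add.commute)
  hence "OPS (\<lambda>n. askey_wilson q (P (Suc n)))"
    using favard[of \<zeta> "\<lambda>n. \<gamma> (int n + 1)" \<beta>] \<zeta>_nz \<gamma>_nz by simp
  thus ?thesis
    using P by (simp add: classical_def)
qed

end
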